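(* Let $\kappa$ be an infinite cardinal. For every infinite cardinal $\lambda\le 2^{2^{\kappa}}$ there is a locally $\kappa$ anti-Urysohn space of cardinality $\lambda$. In particular, for every infinite cardinal $\lambda\le 2^{\mathfrak c}$ there is a locally countable anti-Urysohn space of cardinality $\lambda$.
   Context: "Space" means infinite Hausdorff topological space. A space $X$ is locally $\kappa$ if every point has a neighbourhood of cardinality $\le\kappa$; locally countable means locally $\omega$. A space $X$ is anti-Urysohn (AU) if any two non-empty regular closed subsets of $X$ intersect (a set is regular closed if it is the closure of its interior). $\mathfrak c=2^{\omega}$. *)

theory Defs
  imports "HOL-Analysis.Analysis"
begin

text \<open>Cardinals are the well-order relations of \<^theory>\<open>HOL.BNF_Cardinal_Arithmetic\<close>:
  \<open>Cinfinite r\<close> says that \<open>r\<close> is an infinite cardinal, \<open>natLeq\<close> is \<open>\<omega>\<close>, and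
  \<open>ctwo ^c r\<close> is the power \<open>2\<^sup>r\<close>.\<close>

unbundle cardinal_syntax

definition continuum :: "(nat \<Rightarrow> bool) rel" where
  "continuum = ctwo ^c natLeq"

text \<open>A neighbourhood of a point need not be open.\<close>

definition neighbourhood_of :: "'a topology \<Rightarrow> 'a \<Rightarrow> 'a set \<Rightarrow> bool" where
  "neighbourhood_of X x N \<longleftrightarrow> N \<subseteq> topspace X \<and> (\<exists>U. openin X U \<and> x \<in> U \<and> U \<subseteq> N)"

definition locally_card_le :: "'k rel \<Rightarrow> 'a topology \<Rightarrow> bool" where
  "locally_card_le \<kappa> X \<longleftrightarrow> (\<forall>x \<in> topspace X. \<exists>N. neighbourhood_of X x N \<and> |N| \<le>o \<kappa>)"

definition locally_countable :: "'a topology \<Rightarrow> bool" where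
  "locally_countable X \<longleftrightarrow> locally_card_le natLeq X"

definition regular_closedin :: "'a topology \<Rightarrow> 'a set \<Rightarrow> bool" where
  "regular_closedin X A \<longleftrightarrow> A = X closure_of (X interior_of A)"

text \<open>``Space'' means infinite Hausdorff space, so both properties are part of the definition.\<close>

definition anti_Urysohn_space :: "'a topology \<Rightarrow> bool" where
  "anti_Urysohn_space X \<longleftrightarrow>
     infinite (topspace X) \<and> Hausdorff_space X \<and>
     (\<forall>A B. regular_closedin X A \<and> A \<noteq> {} \<and> regular_closedin X B \<and> B \<noteq> {} \<longrightarrow> A \<inter> B \<noteq> {})"

end

theory Submission
  imports Defs
begin

text \<open>Let \<open>D\<close> be the set of sequences over a set \<open>K\<close> of size \<open>\<kappa>\<close> that eventually take a fixed value,
  with the topology generated by cylinders. Adjoining to \<open>D\<close> points whose neighbourhoods are traced on \<open>D\<close> by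
  prescribed filters keeps \<open>D\<close> open and dense, hence the space locally \<open>\<kappa>\<close>. For any two cylinders we
  adjoin one point that converges to both of them, through ends of \<open>D\<close> that no other point
  uses; this makes any two regular closed sets meet, while the space stays Hausdorff. The first
  coordinate splits \<open>D\<close> into \<open>\<kappa>\<close> many clopen pieces, so a free filter on \<open>K\<close> can be adjoined as a
  further point that is separated from the earlier ones, and Hausdorff's independent family
  supplies \<open>2\<close> to the \<open>2\<^sup>\<kappa>\<close> such filters, pairwise separated by sets. If \<open>\<lambda> < \<kappa>\<close>,
  the construction is carried out over a set of size \<open>\<lambda>\<close> instead.\<close>

section \<open>Free filters on a set, from an independent family\<close>

text \<open>Induction on the number of elements bounds each \<open>S n\<close>; their union is
  countable.\<close>

lemma card_of_Fpow_ordLeq: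
  assumes "infinite A"
  shows "|Fpow A| \<le>o |A|"
proof -
  define S where "S n = {X. X \<subseteq> A \<and> finite X \<and> card X = n}" for n
  have S: "|S n| \<le>o |A|" for n
  proof (induction n)
    case 0
    have "S 0 = {{}}" by (auto simp: S_def)
    then show ?case using assms by (auto intro!: card_of_singl_ordLeq)
  next
    case (Suc n)
    have "S (Suc n) \<subseteq> (\<lambda>(a, X). insert a X) ` (A \<times> S n)"
    proof
      fix X assume "X \<in> S (Suc n)"
      then have X: "X \<subseteq> A" "finite X" "card X = Suc n" by (auto simp: S_def)
      then obtain a where "a \<in> X" by fastforce
      then have "X = insert a (X - {a})" "(a, X - {a}) \<in> A \<times> S n"
        using X by (auto simp: S_def)
      then show "X \<in> (\<lambda>(a, X). insert a X) ` (A \<times> S n)"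
        by (metis (no_types, lifting) case_prod_conv image_eqI)
    qed
    then have "|S (Suc n)| \<le>o |A \<times> S n|" by (rule surj_imp_ordLeq)
    also have "|A \<times> S n| \<le>o |A|"
      using assms Suc card_of_mono1[OF order_refl]
      by (intro card_of_Sigma_ordLeq_infinite ballI)
    finally show ?case .
  qed
  have "Fpow A = (\<Union>n. S n)" by (auto simp: Fpow_def S_def)
  moreover have "|\<Union>n. S n| \<le>o |A|"
    using assms S by (intro card_of_UNION_ordLeq_infinite) (auto simp: infinite_iff_card_of_nat)
  ultimately show ?thesis by simp
qed

text \<open>One point from each symmetric difference of two members suffices. Finite traces that
  tell the members apart are what makes the Hausdorff family independent.\<close>

lemma finite_separating_set:
  assumes "finite \<X>" "\<X> \<subseteq> Pow K"
  obtains F where "finite F" "F \<subseteq> K" "inj_on (\<lambda>X. F \<inter> X) \<X>"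
proof -
  define p where "p X Y = (SOME x. x \<in> X - Y \<union> (Y - X))" for X Y :: "'a set"
  have p: "p X Y \<in> X - Y \<union> (Y - X)" if "X \<noteq> Y" for X Y
    unfolding p_def by (rule someI_ex) (use that in auto)
  let ?F = "(\<lambda>(X, Y). p X Y) ` (\<X> \<times> \<X>) \<inter> K"
  have "inj_on (\<lambda>X. ?F \<inter> X) \<X>"
  proof (rule inj_onI, rule ccontr)
    fix X Y assume XY: "X \<in> \<X>" "Y \<in> \<X>" "?F \<inter> X = ?F \<inter> Y" "X \<noteq> Y"
    have "p X Y \<in> X - Y \<union> (Y - X)" using p XY by blast
    moreover have "p X Y \<in> ?F" using calculation XY assms(2) by (auto intro: rev_image_eqI)
    ultimately show False using XY by blast
  qed
  then show ?thesis using that[of ?F] assms(1) by auto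
qed

text \<open>The filter of \<open>f\<close> is generated by the Hausdorff independent family
  \<open>{(F, \<A>). F \<inter> X \<in> \<A>}\<close>, complemented when \<open>X \<notin> f\<close>; the sets \<open>{(F, \<A>). \<Xi> \<subseteq> F}\<close> make it free.\<close>

lemma separated_free_filters:
  fixes K :: "'a set"
  assumes "infinite K"
  obtains G :: "'a set set \<Rightarrow> 'a filter"
  where "\<And>f. G f \<noteq> bot"
    and "\<And>f. eventually (\<lambda>x. x \<in> K) (G f)"
    and "\<And>f k. eventually (\<lambda>x. x \<noteq> k) (G f)"
    and "\<And>f g. f \<subseteq> Pow K \<Longrightarrow> g \<subseteq> Pow K \<Longrightarrow> f \<noteq> g \<Longrightarrow>
           \<exists>B. eventually (\<lambda>x. x \<in> B) (G f) \<and> eventually (\<lambda>x. x \<notin> B) (G g)"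
proof -
  \<comment> \<open>The independent family lives on \<open>J\<close>, which is no larger than
    \<open>K\<close>; the injection \<open>h\<close> carries the filters over to
    \<open>K\<close>.\<close>
  define J where "J = Fpow K \<times> Fpow (Fpow K)"
  have FK: "|Fpow K| \<le>o |K|" by (rule card_of_Fpow_ordLeq[OF assms])
  have infF: "infinite (Fpow K)"
  proof -
    have "(\<lambda>x. {x}) ` K \<subseteq> Fpow K" by (auto simp: Fpow_def)
    moreover have "infinite ((\<lambda>x. {x}) ` K)"
      using assms by (subst finite_image_iff) (auto simp: inj_on_def)
    ultimately show ?thesis using finite_subset by blast
  qed
  have "|Fpow (Fpow K)| \<le>o |K|"
    using card_of_Fpow_ordLeq[OF infF] FK ordLeq_transitive by blast
  then have "|J| \<le>o |K|"
    unfolding J_def using assms FK by (intro card_of_Sigma_ordLeq_infinite ballI)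
  then obtain h where h: "inj_on h J" "h ` J \<subseteq> K"
    unfolding card_of_ordLeq[symmetric] by blast
  define base where "base f = (\<lambda>(\<Xi>, \<X>). {(F, \<A>) \<in> J. \<Xi> \<subseteq> F \<and> (\<forall>X\<in>\<X>. F \<inter> X \<in> \<A> \<longleftrightarrow> X \<in> f)})"
    for f :: "'a set set"
  define I where "I = Fpow K \<times> Fpow (Pow K)"
  define H where "H f = (INF p\<in>I. principal (base f p))" for f
  have H: "eventually P (H f) \<longleftrightarrow> (\<exists>p\<in>I. \<forall>j\<in>base f p. P j)" for P f
    unfolding H_def
  proof (subst eventually_INF_base)
    show "I \<noteq> {}" by (auto simp: I_def Fpow_not_empty)
    fix p q assume pq: "p \<in> I" "q \<in> I"
    let ?r = "(fst p \<union> fst q, snd p \<union> snd q)"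
    have "?r \<in> I" using pq by (auto simp: I_def Fpow_def)
    moreover have "base f ?r \<subseteq> base f p \<inter> base f q"
      by (auto simp: base_def split: prod.splits)
    ultimately show "\<exists>r\<in>I. principal (base f r) \<le> inf (principal (base f p)) (principal (base f q))"
      by (intro bexI[of _ ?r]) auto
  qed (auto simp: eventually_principal)
  have ne: "base f p \<noteq> {}" if p: "p \<in> I" for f p
  proof -
    obtain \<Xi> \<X> where p': "p = (\<Xi>, \<X>)" by (cases p)
    with p have \<X>: "\<Xi> \<in> Fpow K" "finite \<X>" "\<X> \<subseteq> Pow K" by (auto simp: I_def Fpow_def)
    obtain F0 where F0: "finite F0" "F0 \<subseteq> K" "inj_on (\<lambda>X. F0 \<inter> X) \<X>"
      using finite_separating_set[OF \<X>(2,3)] .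
    define F where "F = F0 \<union> \<Xi>"
    have F: "F \<in> Fpow K" using F0 \<X> by (auto simp: F_def Fpow_def)
    have inj: "X = Y" if "X \<in> \<X>" "Y \<in> \<X>" "F \<inter> X = F \<inter> Y" for X Y
    proof -
      have "F0 \<inter> X = F0 \<inter> Y" using that(3) by (auto simp: F_def)
      then show ?thesis using F0(3) that by (auto dest: inj_onD)
    qed
    \<comment> \<open>Adding \<open>\<Xi>\<close> to \<open>F0\<close> keeps the traces distinct, so
      listing the traces of exactly those members that lie in \<open>f\<close> realises all
      prescribed choices at once.\<close>
    define \<A> where "\<A> = (\<lambda>X. F \<inter> X) ` (\<X> \<inter> f)"
    have "\<A> \<in> Fpow (Fpow K)" using F \<X> by (auto simp: \<A>_def Fpow_def)
    moreover have "F \<inter> X \<in> \<A> \<longleftrightarrow> X \<in> f" if "X \<in> \<X>" for X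
      using inj that by (auto simp: \<A>_def)
    ultimately have "(F, \<A>) \<in> base f p"
      using F by (auto simp: base_def p' J_def F_def)
    then show ?thesis by blast
  qed
  define G where "G f = filtermap h (H f)" for f
  show ?thesis
  proof (rule that[of G])
    show "G f \<noteq> bot" for f
      unfolding G_def trivial_limit_def eventually_filtermap H using ne by blast
    have I: "({}, {}) \<in> I" by (auto simp: I_def Fpow_def)
    show "eventually (\<lambda>x. x \<in> K) (G f)" for f
      unfolding G_def eventually_filtermap H
      using h(2) by (intro bexI[OF _ I]) (auto simp: base_def)
    show "eventually (\<lambda>x. x \<noteq> k) (G f)" for f k
    proof (cases "k \<in> h ` J")
      case True
      then obtain F \<A> where k: "k = h (F, \<A>)" "(F, \<A>) \<in> J" by auto
      then have "finite F" by (auto simp: J_def Fpow_def)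
      \<comment> \<open>The finite set \<open>F\<close> omits some \<open>x\<close>, and requiring
        \<open>x\<close> in the first component excludes the only preimage \<open>(F, \<A>)\<close>
        of \<open>k\<close>.\<close>
      then obtain x where x: "x \<in> K" "x \<notin> F" using assms by (meson finite_subset subsetI)
      have "({x}, {}) \<in> I" using x by (auto simp: I_def Fpow_def)
      then show ?thesis
        unfolding G_def eventually_filtermap H
        using h(1) k x by (intro bexI) (auto simp: base_def dest: inj_onD)
    next
      case False
      then show ?thesis
        unfolding G_def eventually_filtermap H
        by (intro bexI[OF _ I]) (auto simp: base_def)
    qed
    \<comment> \<open>This treats a set in \<open>f\<close> but not in \<open>g\<close>; the
      opposite case follows by exchanging the filters and complementing \<open>B\<close>.\<close>
    have *: "\<exists>B. eventually (\<lambda>x. x \<in> B) (G f) \<and> eventually (\<lambda>x. x \<notin> B) (G g)"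
      if X: "X \<subseteq> K" "X \<in> f" "X \<notin> g" for f g X
    proof -
      have XI: "({}, {X}) \<in> I" using X by (auto simp: I_def Fpow_def)
      show ?thesis
        unfolding G_def eventually_filtermap H
      proof (intro exI conjI bexI[OF _ XI] ballI)
        show "h j \<in> h ` base f ({}, {X})" if "j \<in> base f ({}, {X})" for j using that by blast
        show "h j \<notin> h ` base f ({}, {X})" if "j \<in> base g ({}, {X})" for j
          using that h(1) X by (auto simp: base_def dest: inj_onD)
      qed
    qed
    fix f g :: "'a set set"
    assume fg: "f \<subseteq> Pow K" "g \<subseteq> Pow K" "f \<noteq> g"
    then consider X where "X \<subseteq> K" "X \<in> f" "X \<notin> g" | X where "X \<subseteq> K" "X \<in> g" "X \<notin> f" by blast
    then show "\<exists>B. eventually (\<lambda>x. x \<in> B) (G f) \<and> eventually (\<lambda>x. x \<notin> B) (G g)"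
    proof cases
      case 1
      then show ?thesis by (rule *)
    next
      case 2
      then obtain B where "eventually (\<lambda>x. x \<in> B) (G g)" "eventually (\<lambda>x. x \<notin> B) (G f)"
        using * by blast
      then show ?thesis by (intro exI[of _ "- B"]) auto
    qed
  qed
qed

section \<open>Topologies prescribed by filters on an open dense set\<close>

text \<open>The bijection \<open>h\<close> only relabels the points, so that the space can live on a prescribed type.\<close>

lemma anti_Urysohn_trace_topology:
  fixes h :: "'z \<Rightarrow> 'l" and \<iota> :: "'d \<Rightarrow> 'z" and \<Phi> :: "'z \<Rightarrow> 'd filter"
  assumes h: "inj_on h Z" and Z: "infinite Z"
    and \<iota>: "inj_on \<iota> D" "\<iota> ` D \<subseteq> Z"
    and D: "|D| \<le>o \<kappa>" and \<kappa>: "Cinfinite \<kappa>"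
    and nontriv: "\<And>z. z \<in> Z \<Longrightarrow> \<Phi> z \<noteq> bot"
    and onD: "\<And>z. z \<in> Z \<Longrightarrow> eventually (\<lambda>d. d \<in> D) (\<Phi> z)"
    and centred: "\<And>P d. d \<in> D \<Longrightarrow> eventually P (\<Phi> (\<iota> d)) \<Longrightarrow> P d"
    and sep: "\<And>y z. y \<in> Z \<Longrightarrow> z \<in> Z \<Longrightarrow> y \<noteq> z \<Longrightarrow>
       \<exists>Q. (\<forall>d\<in>D. eventually (\<lambda>e. Q e = Q d) (\<Phi> (\<iota> d))) \<and>
           eventually Q (\<Phi> y) \<and> eventually (\<lambda>e. \<not> Q e) (\<Phi> z)"
    and linked: "\<And>A B a b. A \<subseteq> D \<Longrightarrow> B \<subseteq> D \<Longrightarrow> a \<in> A \<Longrightarrow> b \<in> B \<Longrightarrow>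
       \<forall>d\<in>A. eventually (\<lambda>e. e \<in> A) (\<Phi> (\<iota> d)) \<Longrightarrow>
       \<forall>d\<in>B. eventually (\<lambda>e. e \<in> B) (\<Phi> (\<iota> d)) \<Longrightarrow>
       \<exists>z\<in>Z. frequently (\<lambda>e. e \<in> A) (\<Phi> z) \<and> frequently (\<lambda>e. e \<in> B) (\<Phi> z)"
  shows "\<exists>X. topspace X = h ` Z \<and> anti_Urysohn_space X \<and> locally_card_le \<kappa> X"
proof -
  \<comment> \<open>Openness at a point is tested only on the trace in \<open>D\<close>, so no other
    adjoined point enters the requirement. This makes \<open>D\<close> with one further point
    open.\<close>
  define opn where "opn W \<longleftrightarrow> W \<subseteq> h ` Z \<and> (\<forall>z\<in>Z. h z \<in> W \<longrightarrow> eventually (\<lambda>d. h (\<iota> d) \<in> W) (\<Phi> z))" for W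
  have "istopology opn"
    unfolding istopology_def
  proof (intro conjI allI impI)
    fix S T assume "opn S" "opn T"
    then show "opn (S \<inter> T)" unfolding opn_def by (auto intro: eventually_conj)
  next
    fix \<K> assume \<K>: "\<forall>S\<in>\<K>. opn S"
    show "opn (\<Union>\<K>)"
      unfolding opn_def
    proof (intro conjI ballI impI)
      show "\<Union>\<K> \<subseteq> h ` Z" using \<K> unfolding opn_def by blast
      fix z assume "z \<in> Z" "h z \<in> \<Union>\<K>"
      then obtain S where "S \<in> \<K>" "eventually (\<lambda>d. h (\<iota> d) \<in> S) (\<Phi> z)"
        using \<K> unfolding opn_def by blast
      then show "eventually (\<lambda>d. h (\<iota> d) \<in> \<Union>\<K>) (\<Phi> z)"
        by (auto elim!: eventually_mono)
    qed
  qed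
  define X where "X = topology opn"
  have opn: "openin X W \<longleftrightarrow> opn W" for W
    unfolding X_def by (simp add: topology_inverse'[OF \<open>istopology opn\<close>])
  have top: "topspace X = h ` Z"
  proof (rule antisym)
    show "topspace X \<subseteq> h ` Z"
      using openin_topspace[of X] unfolding opn opn_def by blast
    have "eventually (\<lambda>d. h (\<iota> d) \<in> h ` Z) (\<Phi> z)" if "z \<in> Z" for z
      using onD[OF that] by eventually_elim (use \<iota> in blast)
    then have "openin X (h ` Z)" unfolding opn opn_def by blast
    then show "h ` Z \<subseteq> topspace X" by (rule openin_subset)
  qed
  have h_eq: "h y = h z \<longleftrightarrow> y = z" if "y \<in> Z" "z \<in> Z" for y z
    using h that by (auto dest: inj_onD)
  have \<iota>_eq: "\<iota> d = \<iota> e \<longleftrightarrow> d = e" if "d \<in> D" "e \<in> D" for d e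
    using \<iota> that by (auto dest: inj_onD)
  have \<iota>Z: "\<iota> d \<in> Z" if "d \<in> D" for d using \<iota> that by blast
  have nbhd: "openin X (insert (h z) ((h \<circ> \<iota>) ` U))"
    if "z \<in> Z" "U \<subseteq> D" "\<forall>d\<in>U. eventually (\<lambda>e. e \<in> U) (\<Phi> (\<iota> d))" "eventually (\<lambda>e. e \<in> U) (\<Phi> z)" for z U
    unfolding opn opn_def
  proof (intro conjI ballI impI)
    show "insert (h z) ((h \<circ> \<iota>) ` U) \<subseteq> h ` Z" using that \<iota>Z by auto
    fix y assume y: "y \<in> Z" "h y \<in> insert (h z) ((h \<circ> \<iota>) ` U)"
    have "y = z \<or> (\<exists>d\<in>U. y = \<iota> d)"
      using y that(1,2) h_eq \<iota>Z by (auto simp: subset_iff)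
    then have "eventually (\<lambda>e. e \<in> U) (\<Phi> y)" using that by blast
    then show "eventually (\<lambda>d. h (\<iota> d) \<in> insert (h z) ((h \<circ> \<iota>) ` U)) (\<Phi> y)"
      by (rule eventually_mono) auto
  qed
  have haus: "Hausdorff_space X"
    unfolding Hausdorff_space_def
  proof (intro allI impI)
    fix x1 x2 assume "x1 \<in> topspace X \<and> x2 \<in> topspace X \<and> x1 \<noteq> x2"
    then obtain y z where yz: "y \<in> Z" "z \<in> Z" "y \<noteq> z" "x1 = h y" "x2 = h z"
      unfolding top by blast
    obtain Q where Q: "\<forall>d\<in>D. eventually (\<lambda>e. Q e = Q d) (\<Phi> (\<iota> d))"
      "eventually Q (\<Phi> y)" "eventually (\<lambda>e. \<not> Q e) (\<Phi> z)"
      using sep[OF yz(1-3)] by blast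
    define U where "U = {d \<in> D. Q d}"
    define V where "V = {d \<in> D. \<not> Q d}"
    \<comment> \<open>Stated for arbitrary \<open>P\<close> so that it applies to \<open>Q\<close>
      and to its negation, which split \<open>D\<close> into two open pieces.\<close>
    have "openin X (insert (h w) ((h \<circ> \<iota>) ` {d \<in> D. P d}))"
      if w: "w \<in> Z" "eventually P (\<Phi> w)"
        and P: "\<forall>d\<in>D. eventually (\<lambda>e. P e = P d) (\<Phi> (\<iota> d))" for w P
    proof (rule nbhd)
      show "eventually (\<lambda>e. e \<in> {d \<in> D. P d}) (\<Phi> w)"
        using w(2) onD[OF w(1)] by eventually_elim simp
      show "\<forall>d\<in>{d \<in> D. P d}. eventually (\<lambda>e. e \<in> {d \<in> D. P d}) (\<Phi> (\<iota> d))"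
      proof
        fix d assume d: "d \<in> {d \<in> D. P d}"
        then have "eventually (\<lambda>e. P e = P d) (\<Phi> (\<iota> d))" "eventually (\<lambda>e. e \<in> D) (\<Phi> (\<iota> d))"
          using P onD \<iota>Z by auto
        then show "eventually (\<lambda>e. e \<in> {d \<in> D. P d}) (\<Phi> (\<iota> d))"
          by eventually_elim (use d in auto)
      qed
    qed (use w in auto)
    from this[of y Q] this[of z "\<lambda>e. \<not> Q e"]
    have "openin X (insert (h y) ((h \<circ> \<iota>) ` U))" "openin X (insert (h z) ((h \<circ> \<iota>) ` V))"
      using yz Q by (simp_all add: U_def V_def)
    moreover have "disjnt (insert (h y) ((h \<circ> \<iota>) ` U)) (insert (h z) ((h \<circ> \<iota>) ` V))"
    proof -
      have "h y \<noteq> h z" using yz h_eq by blast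
      \<comment> \<open>If \<open>y\<close> is itself a point of \<open>D\<close>, then
        \<open>centred\<close> puts it on the side where \<open>Q\<close> holds, hence outside
        \<open>V\<close>. The next claim is the same for \<open>z\<close> and
        \<open>U\<close>.\<close>
      moreover have "h y \<noteq> h (\<iota> d)" if "d \<in> V" for d
        using that centred[of d Q] Q(2) h_eq yz \<iota>Z by (auto simp: V_def)
      moreover have "h z \<noteq> h (\<iota> d)" if "d \<in> U" for d
        using that centred[of d "\<lambda>e. \<not> Q e"] Q(3) h_eq yz \<iota>Z by (auto simp: U_def)
      moreover have "h (\<iota> d) \<noteq> h (\<iota> e)" if "d \<in> U" "e \<in> V" for d e
        using that h_eq \<iota>Z \<iota>_eq by (auto simp: U_def V_def)
      ultimately show ?thesis by (fastforce simp: disjnt_iff)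
    qed
    ultimately show "\<exists>U V. openin X U \<and> openin X V \<and> x1 \<in> U \<and> x2 \<in> V \<and> disjnt U V"
      using yz by blast
  qed
  \<comment> \<open>Density of \<open>D\<close> comes from the properness of the filters. The second
    conjunct says that the trace is open within \<open>D\<close>, as \<open>linked\<close>
    demands.\<close>
  have trace: "{d \<in> D. h (\<iota> d) \<in> W} \<noteq> {} \<and>
      (\<forall>d\<in>{d \<in> D. h (\<iota> d) \<in> W}. eventually (\<lambda>e. e \<in> {d \<in> D. h (\<iota> d) \<in> W}) (\<Phi> (\<iota> d)))"
    if W: "openin X W" "W \<noteq> {}" for W
  proof
    have ev: "eventually (\<lambda>e. e \<in> {d \<in> D. h (\<iota> d) \<in> W}) (\<Phi> z)" if "z \<in> Z" "h z \<in> W" for z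
    proof -
      have "eventually (\<lambda>d. h (\<iota> d) \<in> W) (\<Phi> z)" using W that unfolding opn opn_def by blast
      with onD[OF that(1)] show ?thesis by eventually_elim simp
    qed
    obtain z where z: "z \<in> Z" "h z \<in> W" using W unfolding opn opn_def by blast
    show "{d \<in> D. h (\<iota> d) \<in> W} \<noteq> {}"
      using eventually_happens[OF ev[OF z]] nontriv[OF z(1)] by blast
    show "\<forall>d\<in>{d \<in> D. h (\<iota> d) \<in> W}. eventually (\<lambda>e. e \<in> {d \<in> D. h (\<iota> d) \<in> W}) (\<Phi> (\<iota> d))"
      using ev \<iota>Z by blast
  qed
  have closure: "h z \<in> X closure_of W"
    if "z \<in> Z" "frequently (\<lambda>e. e \<in> {d \<in> D. h (\<iota> d) \<in> W}) (\<Phi> z)" for z W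
    unfolding in_closure_of
  proof (intro conjI allI impI)
    show "h z \<in> topspace X" using that top by blast
    fix T assume "h z \<in> T \<and> openin X T"
    then have "eventually (\<lambda>d. h (\<iota> d) \<in> T) (\<Phi> z)" using that unfolding opn opn_def by blast
    with that(2) have "frequently (\<lambda>e. e \<in> {d \<in> D. h (\<iota> d) \<in> W} \<and> h (\<iota> e) \<in> T) (\<Phi> z)"
      by (rule frequently_eventually_frequently)
    then show "\<exists>y. y \<in> W \<and> y \<in> T" using frequently_ex by blast
  qed
  have "anti_Urysohn_space X"
    unfolding anti_Urysohn_space_def
  proof (intro conjI allI impI)
    show "infinite (topspace X)" using top h Z by (simp add: finite_image_iff)
    show "Hausdorff_space X" by (rule haus)
    fix A B assume AB: "regular_closedin X A \<and> A \<noteq> {} \<and> regular_closedin X B \<and> B \<noteq> {}"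
    define U where "U = X interior_of A"
    define V where "V = X interior_of B"
    have A: "A = X closure_of U" and B: "B = X closure_of V"
      using AB unfolding regular_closedin_def U_def V_def by blast+
    have U: "openin X U" "U \<noteq> {}" using A AB by (auto simp: U_def)
    have V: "openin X V" "V \<noteq> {}" using B AB by (auto simp: V_def)
    obtain u v where u: "u \<in> {d \<in> D. h (\<iota> d) \<in> U}" and v: "v \<in> {d \<in> D. h (\<iota> d) \<in> V}"
      using trace[OF U] trace[OF V] by blast
    have "\<exists>z\<in>Z. frequently (\<lambda>e. e \<in> {d \<in> D. h (\<iota> d) \<in> U}) (\<Phi> z)
            \<and> frequently (\<lambda>e. e \<in> {d \<in> D. h (\<iota> d) \<in> V}) (\<Phi> z)"
      by (rule linked[OF _ _ u v]) (use trace[OF U] trace[OF V] in auto)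
    then show "A \<inter> B \<noteq> {}" using closure unfolding A B by blast
  qed
  moreover have "locally_card_le \<kappa> X"
    unfolding locally_card_le_def
  proof
    fix x assume "x \<in> topspace X"
    then obtain z where z: "z \<in> Z" "x = h z" using top by blast
    \<comment> \<open>All of \<open>D\<close> together with the given point is an open
      neighbourhood, at most one point larger than \<open>D\<close>.\<close>
    let ?N = "insert (h z) ((h \<circ> \<iota>) ` D)"
    have N: "openin X ?N" by (rule nbhd) (use z onD \<iota>Z in auto)
    have "|(h \<circ> \<iota>) ` D| \<le>o \<kappa>" using card_of_image D ordLeq_transitive by blast
    moreover have "|{h z}| \<le>o \<kappa>"
      using \<kappa> by (intro Card_order_singl_ordLeq) (auto simp: cinfinite_def)
    ultimately have "|{h z} \<union> (h \<circ> \<iota>) ` D| \<le>o \<kappa>"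
      using \<kappa> by (intro card_of_Un_ordLeq_infinite_Field) (auto simp: cinfinite_def)
    then have "neighbourhood_of X x ?N \<and> |?N| \<le>o \<kappa>"
      using N z openin_subset[OF N] by (auto simp: neighbourhood_of_def)
    then show "\<exists>N. neighbourhood_of X x N \<and> |N| \<le>o \<kappa>" by blast
  qed
  ultimately show ?thesis using top by blast
qed


section \<open>Stems and eventually constant sequences\<close>

text \<open>\<open>stem D x\<close> is the trace on \<open>D\<close> of the neighbourhood filter of \<open>x\<close> in the product of
  countably many discrete spaces.\<close>

definition stem :: "(nat \<Rightarrow> 'a) set \<Rightarrow> (nat \<Rightarrow> 'a) \<Rightarrow> (nat \<Rightarrow> 'a) filter" where
  "stem D x = (INF n. principal {d \<in> D. \<forall>i<n. d i = x i})"

lemma eventually_stem: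
  "eventually P (stem D x) \<longleftrightarrow> (\<exists>n. \<forall>d\<in>D. (\<forall>i<n. d i = x i) \<longrightarrow> P d)"
  unfolding stem_def
proof (subst eventually_INF_base)
  fix m n :: nat
  show "\<exists>k\<in>UNIV. principal {d \<in> D. \<forall>i<k. d i = x i}
          \<le> inf (principal {d \<in> D. \<forall>i<m. d i = x i}) (principal {d \<in> D. \<forall>i<n. d i = x i})"
    by (rule bexI[of _ "max m n"]) auto
qed (auto simp: eventually_principal)

lemma eventually_stem_agree: "eventually (\<lambda>d. \<forall>i<n. d i = x i) (stem D x)"
  unfolding eventually_stem by blast

lemma eventually_stem_mem: "eventually (\<lambda>d. d \<in> D) (stem D x)"
  unfolding eventually_stem by blast

lemma eventually_stem_self: "eventually P (stem D x) \<Longrightarrow> x \<in> D \<Longrightarrow> P x"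
  unfolding eventually_stem by blast

text \<open>Disagreement is stated for all large lengths, so that one common length can later serve
  several pairs of sequences.\<close>

lemma ex_agree_bound:
  assumes "(x :: nat \<Rightarrow> 'a) \<noteq> y"
  obtains n where "\<And>m. m \<ge> n \<Longrightarrow> \<not> (\<forall>i<m. y i = x i)"
proof -
  obtain i where "x i \<noteq> y i" using assms by blast
  then show ?thesis using that[of "Suc i"] by (metis Suc_le_lessD)
qed

definition eventually_constant_seqs :: "'a set \<Rightarrow> 'a \<Rightarrow> (nat \<Rightarrow> 'a) set" where
  "eventually_constant_seqs K k = {d. range d \<subseteq> K \<and> (\<exists>n. \<forall>i\<ge>n. d i = k)}"

text \<open>The finite part of the graph where a sequence differs from \<open>k\<close> determines
  it, which injects these sequences into the finite subsets of
  \<open>nat \<times> K\<close>.\<close>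

lemma card_of_eventually_constant_seqs:
  fixes K :: "'a set"
  assumes "infinite K"
  shows "|eventually_constant_seqs K k| \<le>o |K|"
proof -
  define supp where "supp d = {(i, d i) |i. d i \<noteq> k}" for d :: "nat \<Rightarrow> 'a"
  have nat: "|UNIV :: nat set| \<le>o |K|" using assms by (simp add: infinite_iff_card_of_nat)
  have "|eventually_constant_seqs K k| \<le>o |Fpow ((UNIV :: nat set) \<times> K)|"
    unfolding card_of_ordLeq[symmetric]
  proof (intro exI[of _ supp] conjI)
    show "inj_on supp (eventually_constant_seqs K k)"
    proof (rule inj_onI, rule ext)
      fix d e i assume eq: "supp d = supp e"
      have "(i, x) \<in> supp d \<longleftrightarrow> (i, x) \<in> supp e" for x using eq by simp
      then show "d i = e i" unfolding supp_def by (cases "d i = k") auto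
    qed
    show "supp ` eventually_constant_seqs K k \<subseteq> Fpow (UNIV \<times> K)"
    proof
      fix S assume "S \<in> supp ` eventually_constant_seqs K k"
      then obtain d n where d: "S = supp d" "range d \<subseteq> K" "\<forall>i\<ge>n. d i = k"
        by (auto simp: eventually_constant_seqs_def)
      have "S \<subseteq> (\<lambda>i. (i, d i)) ` {..<n}"
        using d by (force simp: supp_def not_le[symmetric])
      then have "finite S" by (rule finite_subset) auto
      then show "S \<in> Fpow (UNIV \<times> K)" using d by (auto simp: Fpow_def supp_def)
    qed
  qed
  also have "|Fpow ((UNIV :: nat set) \<times> K)| \<le>o |(UNIV :: nat set) \<times> K|"
    using assms by (intro card_of_Fpow_ordLeq) (auto dest: finite_cartesian_productD2)
  also have "|(UNIV :: nat set) \<times> K| \<le>o |K|"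
    using assms nat card_of_mono1[OF order_refl] by (intro card_of_Sigma_ordLeq_infinite ballI)
  finally show ?thesis .
qed

section \<open>The space with its linking points and free points\<close>

text \<open>The space consists of \<open>D\<close>, the points \<open>(tail a n k, tail b n k)\<close>, attached to two ends of
  \<open>D\<close> at once so as to link the cylinders of \<open>a\<close> and \<open>b\<close>, and the points \<open>f \<in> \<Lambda>\<close>, attached along
  the free filter \<open>G f\<close> on the first coordinate.\<close>

lemma ex_anti_Urysohn_of_family:
  fixes K :: "'a set" and \<Lambda> :: "'a set set set" and Y :: "'l set"
  assumes K: "infinite K" and \<Lambda>: "\<Lambda> \<subseteq> Pow (Pow K)" and le: "|K| \<le>o |\<Lambda>|" and Y: "|\<Lambda>| =o |Y|"
    and \<kappa>: "Cinfinite \<kappa>" "|K| \<le>o \<kappa>"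
  shows "\<exists>X. topspace X = Y \<and> anti_Urysohn_space X \<and> locally_card_le \<kappa> X"
proof -
  obtain G :: "'a set set \<Rightarrow> 'a filter" where
    G: "\<And>f. G f \<noteq> bot" "\<And>f. eventually (\<lambda>x. x \<in> K) (G f)"
       "\<And>f k. eventually (\<lambda>x. x \<noteq> k) (G f)"
       "\<And>f g. f \<subseteq> Pow K \<Longrightarrow> g \<subseteq> Pow K \<Longrightarrow> f \<noteq> g \<Longrightarrow>
           \<exists>B. eventually (\<lambda>x. x \<in> B) (G f) \<and> eventually (\<lambda>x. x \<notin> B) (G g)"
    by (rule separated_free_filters[OF K]) blast
  obtain k0 where k0: "k0 \<in> K" using K by fastforce
  define D where "D = eventually_constant_seqs K k0"
  have cD: "|D| \<le>o |K|" unfolding D_def by (rule card_of_eventually_constant_seqs[OF K])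
  have cT: "|D \<times> D \<times> (UNIV :: nat set)| \<le>o |K|"
    using K cD by (intro card_of_Sigma_ordLeq_infinite ballI) (auto simp: infinite_iff_card_of_nat)
  \<comment> \<open>Sparing \<open>k0\<close> lets each triple have its own eventual value under
    \<open>c\<close>, different from the eventual value of the points of \<open>D\<close>.\<close>
  have "|K| =o |K - {k0}|"
    using infinite_imp_bij_betw[OF K] card_of_ordIso by blast
  with cT have "|D \<times> D \<times> (UNIV :: nat set)| \<le>o |K - {k0}|" using ordLeq_ordIso_trans by blast
  then obtain c where c: "inj_on c (D \<times> D \<times> (UNIV :: nat set))"
      "c ` (D \<times> D \<times> UNIV) \<subseteq> K - {k0}"
    unfolding card_of_ordLeq[symmetric] by blast
  define tail where "tail a n k = (\<lambda>i. if i < n then a i else k)" for a :: "nat \<Rightarrow> 'a" and n k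
  define link where "link = (\<lambda>(a, b, n). (tail a n (c (a, b, n)), tail b n (c (a, b, n))))"
  \<comment> \<open>Points of \<open>D\<close> are coded as diagonal pairs, so that the same
    \<open>sup\<close> of two stems also gives their own filters.\<close>
  define S where "S = (\<lambda>d. (d, d)) ` D \<union> link ` (D \<times> D \<times> UNIV)"
  define Z where "Z = S <+> \<Lambda>"
  \<comment> \<open>At a free point, \<open>G f\<close> is copied into \<open>D\<close> along the
    sequences that equal \<open>k0\<close> beyond coordinate 0.\<close>
  define \<Phi> where "\<Phi> = case_sum (\<lambda>(x, y). sup (stem D x) (stem D y))
      (\<lambda>f. filtermap (\<lambda>k. (\<lambda>_. k0)(0 := k)) (G f))"
  define \<iota> where "\<iota> = (\<lambda>d. Inl (d, d) :: (nat \<Rightarrow> 'a) \<times> (nat \<Rightarrow> 'a) + 'a set set)"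
  have \<Phi>_Inl: "eventually P (\<Phi> (Inl (x, y))) \<longleftrightarrow> eventually P (stem D x) \<and> eventually P (stem D y)" for P x y
    by (simp add: \<Phi>_def eventually_sup)
  have \<Phi>_Inr: "eventually P (\<Phi> (Inr f)) \<longleftrightarrow> eventually (\<lambda>k. P ((\<lambda>_. k0)(0 := k))) (G f)" for P f
    by (simp add: \<Phi>_def eventually_filtermap)
  have DI: "d \<in> D" if "range d \<subseteq> K" "\<And>i. i \<ge> n \<Longrightarrow> d i = k0" for d n
    using that by (auto simp: D_def eventually_constant_seqs_def)
  have DK: "d i \<in> K" if "d \<in> D" for d i
    using that by (auto simp: D_def eventually_constant_seqs_def)
  \<comment> \<open>\<open>tail a n k\<close> may lie outside \<open>D\<close>; replacing it by
    \<open>k0\<close> from \<open>max m n\<close> on gives a point of \<open>D\<close> near the tail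
    and still in the cylinder of \<open>a\<close>.\<close>
  have tail_approx: "\<exists>d\<in>D. (\<forall>i<m. d i = tail a n k i) \<and> (\<forall>i<n. d i = a i)"
    if "a \<in> D" "k \<in> K" for a n k m
  proof
    let ?d = "\<lambda>i. if i < max m n then tail a n k i else k0"
    show "?d \<in> D" by (rule DI[of _ "max m n"]) (use that k0 DK in \<open>auto simp: tail_def\<close>)
    show "(\<forall>i<m. ?d i = tail a n k i) \<and> (\<forall>i<n. ?d i = a i)" by (auto simp: tail_def)
  qed
  have ck: "c (a, b, n) \<in> K" "c (a, b, n) \<noteq> k0" if "a \<in> D" "b \<in> D" for a b n
    using c(2) that by (auto simp: image_subset_iff)
  have ev_k0: "eventually (\<lambda>i. d i = k0) sequentially" if "d \<in> D" for d
    using that by (auto simp: D_def eventually_constant_seqs_def eventually_sequentially)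
  have ev_tail: "eventually (\<lambda>i. tail a n k i = k) sequentially" for a n k
    unfolding eventually_sequentially by (auto simp: tail_def intro: exI[of _ n])
  have limit_unique: "k = l"
    if "eventually (\<lambda>i. x i = k) sequentially" "eventually (\<lambda>i. x i = l) sequentially"
    for x :: "nat \<Rightarrow> 'a" and k l
  proof -
    have "eventually (\<lambda>i :: nat. k = l) sequentially"
      using that by eventually_elim simp
    then show ?thesis by simp
  qed
  have disj: "{x, y} \<inter> {x', y'} = {}" if "(x, y) \<in> S" "(x', y') \<in> S" "(x, y) \<noteq> (x', y')" for x y x' y'
  proof -
    \<comment> \<open>The eventual value of both coordinates is \<open>k0\<close> on the diagonal
      and \<open>c t\<close> at \<open>link t\<close>. Pairs sharing a coordinate share this value:
      two links then coincide because \<open>c\<close> is injective, and two diagonal pairs coincide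
      outright.\<close>
    define code where "code p k \<longleftrightarrow> eventually (\<lambda>i. fst p i = k) sequentially \<and>
      eventually (\<lambda>i. snd p i = k) sequentially" for p :: "(nat \<Rightarrow> 'a) \<times> (nat \<Rightarrow> 'a)" and k
    have code: "(\<exists>d\<in>D. p = (d, d) \<and> code p k0) \<or>
        (\<exists>t\<in>D \<times> D \<times> UNIV. p = link t \<and> code p (c t) \<and> c t \<noteq> k0)" if "p \<in> S" for p
      using that[unfolded S_def]
    proof (elim UnE imageE)
      fix d assume "p = (d, d)" "d \<in> D"
      then show ?thesis using ev_k0 by (auto simp: code_def)
    next
      fix t assume t: "p = link t" "t \<in> D \<times> D \<times> UNIV"
      then obtain a b n where "t = (a, b, n)" "a \<in> D" "b \<in> D" by auto
      then have "code p (c t)" "c t \<noteq> k0" using t(1) ev_tail ck by (simp_all add: code_def link_def)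
      then show ?thesis using t by blast
    qed
    show ?thesis
    proof (rule ccontr)
      assume "{x, y} \<inter> {x', y'} \<noteq> {}"
      then have eq: "k = l" if "code (x, y) k" "code (x', y') l" for k l
        using that limit_unique unfolding code_def by auto
      show False
        using code[OF that(1)] code[OF that(2)]
      proof (elim disjE bexE conjE)
        fix d e assume "(x, y) = (d, d)" "(x', y') = (e, e)"
        then show False using \<open>{x, y} \<inter> {x', y'} \<noteq> {}\<close> that(3) by auto
      next
        fix t u assume "(x, y) = link t" "(x', y') = link u" "code (x, y) (c t)" "code (x', y') (c u)"
          "t \<in> D \<times> D \<times> UNIV" "u \<in> D \<times> D \<times> UNIV"
        then show False using eq c(1) that(3) by (metis inj_onD)
      qed (use eq in metis)+
    qed
  qed
  have S_K: "|S| \<le>o |K|"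
  proof -
    have "|(\<lambda>d. (d, d)) ` D| \<le>o |K|" using card_of_image cD ordLeq_transitive by blast
    moreover have "|link ` (D \<times> D \<times> UNIV)| \<le>o |K|" using card_of_image cT ordLeq_transitive by blast
    ultimately show ?thesis
      unfolding S_def using K
      by (intro card_of_Un_ordLeq_infinite_Field) (auto simp: Field_card_of card_of_card_order_on)
  qed
  have inf\<Lambda>: "infinite \<Lambda>" using K le card_of_ordLeq_infinite by blast
  have "|S <+> \<Lambda>| =o |\<Lambda>|"
    using card_of_Plus_infinite2[OF inf\<Lambda>] S_K le ordLeq_transitive by blast
  then have "|Z| =o |Y|" unfolding Z_def using Y ordIso_transitive by blast
  then obtain h where h: "bij_betw h Z Y" using card_of_ordIso by blast
  \<comment> \<open>A predicate of finitely many coordinates is locally constant on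
    \<open>D\<close>; all separations below use such predicates.\<close>
  have clopen: "\<forall>d\<in>D. eventually (\<lambda>e. Q e = Q d) (\<Phi> (\<iota> d))"
    if "\<And>d e. \<forall>i<n. d i = e i \<Longrightarrow> Q d = Q e" for Q and n :: nat
  proof
    fix d assume "d \<in> D"
    have "eventually (\<lambda>e. Q e = Q d) (stem D d)"
      using eventually_stem_agree[of n d D] by eventually_elim (rule that)
    then show "eventually (\<lambda>e. Q e = Q d) (\<Phi> (\<iota> d))" by (simp add: \<iota>_def \<Phi>_Inl)
  qed
  let ?sep = "\<lambda>y z. \<exists>Q. (\<forall>d\<in>D. eventually (\<lambda>e. Q e = Q d) (\<Phi> (\<iota> d))) \<and>
           eventually Q (\<Phi> y) \<and> eventually (\<lambda>e. \<not> Q e) (\<Phi> z)"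
  have sep_sym: "?sep z y" if sep: "?sep y z" for y z
  proof -
    obtain Q where "\<forall>d\<in>D. eventually (\<lambda>e. Q e = Q d) (\<Phi> (\<iota> d))"
       "eventually Q (\<Phi> y)" "eventually (\<lambda>e. \<not> Q e) (\<Phi> z)" using sep by blast
    then show ?thesis by (intro exI[of _ "\<lambda>e. \<not> Q e"]) simp
  qed
  have sep_ends: "?sep (Inl p) (Inl q)" if "p \<in> S" "q \<in> S" "p \<noteq> q" for p q
  proof -
    obtain x y x' y' where pq: "p = (x, y)" "q = (x', y')" by fastforce
    then have "x \<noteq> x'" "x \<noteq> y'" "y \<noteq> x'" "y \<noteq> y'" using disj[of x y x' y'] that by auto
    then obtain n1 n2 n3 n4 where n: "\<And>m. m \<ge> n1 \<Longrightarrow> \<not> (\<forall>i<m. x' i = x i)"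
      "\<And>m. m \<ge> n2 \<Longrightarrow> \<not> (\<forall>i<m. y' i = x i)" "\<And>m. m \<ge> n3 \<Longrightarrow> \<not> (\<forall>i<m. x' i = y i)"
      "\<And>m. m \<ge> n4 \<Longrightarrow> \<not> (\<forall>i<m. y' i = y i)"
      by (metis ex_agree_bound)
    \<comment> \<open>With \<open>m\<close> this large, neither coordinate of \<open>q\<close> lies
      in the two cylinders of length \<open>m\<close> around the coordinates of
      \<open>p\<close>.\<close>
    define m where "m = Max {n1, n2, n3, n4}"
    define Q where "Q e \<longleftrightarrow> (\<forall>i<m. e i = x i) \<or> (\<forall>i<m. e i = y i)" for e
    have m: "\<not> Q x'" "\<not> Q y'" using n[of m] unfolding Q_def m_def by auto
    have Q: "Q d = Q e" if "\<forall>i<m. d i = e i" for d e using that by (simp add: Q_def)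
    show ?thesis
    proof (intro exI conjI)
      show "\<forall>d\<in>D. eventually (\<lambda>e. Q e = Q d) (\<Phi> (\<iota> d))" by (rule clopen) (rule Q)
      show "eventually Q (\<Phi> (Inl p))"
        unfolding pq \<Phi>_Inl
        by (intro conjI eventually_mono[OF eventually_stem_agree[of m]]) (auto simp: Q_def)
      show "eventually (\<lambda>e. \<not> Q e) (\<Phi> (Inl q))"
        unfolding pq \<Phi>_Inl
        by (intro conjI eventually_mono[OF eventually_stem_agree[of m]]) (use m Q in blast)+
    qed
  qed
  \<comment> \<open>Coordinate 0 suffices: it takes at most two values near \<open>p\<close>, and
    freeness of \<open>G f\<close> avoids both.\<close>
  have sep_mixed: "?sep (Inl p) (Inr f)" for p f
  proof -
    obtain x y where p: "p = (x, y)" by fastforce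
    show ?thesis
    proof (intro exI[of _ "\<lambda>e. e 0 = x 0 \<or> e 0 = y 0"] conjI)
      show "eventually (\<lambda>e. e 0 = x 0 \<or> e 0 = y 0) (\<Phi> (Inl p))"
        unfolding p \<Phi>_Inl
        by (intro conjI eventually_mono[OF eventually_stem_agree[of 1]]) auto
      show "eventually (\<lambda>e. \<not> (e 0 = x 0 \<or> e 0 = y 0)) (\<Phi> (Inr f))"
        unfolding \<Phi>_Inr using G(3)[of "x 0" f] G(3)[of "y 0" f] by eventually_elim simp
    qed (rule clopen[of 1], auto)
  qed
  have sep_free: "?sep (Inr f) (Inr g)" if fg: "f \<in> \<Lambda>" "g \<in> \<Lambda>" "f \<noteq> g" for f g
  proof -
    have "f \<subseteq> Pow K" "g \<subseteq> Pow K" using fg \<Lambda> by auto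
    then obtain B where "eventually (\<lambda>x. x \<in> B) (G f)" "eventually (\<lambda>x. x \<notin> B) (G g)"
      using G(4)[OF _ _ fg(3)] by blast
    then show ?thesis
      by (intro exI[of _ "\<lambda>e. e 0 \<in> B"] conjI clopen[of 1]) (auto simp: \<Phi>_Inr)
  qed
  have stem_nontriv: "stem D x \<noteq> bot" if "\<And>m. \<exists>d\<in>D. \<forall>i<m. d i = x i" for x
    unfolding trivial_limit_def eventually_stem using that by blast
  have linkD: "stem D (tail a n k) \<noteq> bot" if "a \<in> D" "k \<in> K" for a n k
    using tail_approx[OF that] by (intro stem_nontriv) blast
  have "\<exists>X. topspace X = h ` Z \<and> anti_Urysohn_space X \<and> locally_card_le \<kappa> X"
  proof (rule anti_Urysohn_trace_topology)
    show "inj_on h Z" using h by (rule bij_betw_imp_inj_on)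
    show "infinite Z" using inf\<Lambda> by (simp add: Z_def)
    show "inj_on \<iota> D" by (auto simp: \<iota>_def inj_on_def)
    show "\<iota> ` D \<subseteq> Z" by (auto simp: \<iota>_def Z_def S_def)
    show "|D| \<le>o \<kappa>" using cD \<kappa> ordLeq_transitive by blast
    show "Cinfinite \<kappa>" by fact
    show "\<Phi> z \<noteq> bot" if "z \<in> Z" for z
    proof (cases z)
      case (Inl p)
      then have "p \<in> S" using that by (auto simp: Z_def)
      then consider d where "d \<in> D" "p = (d, d)"
        | a b n where "a \<in> D" "b \<in> D" "p = link (a, b, n)" by (auto simp: S_def)
      then show ?thesis
      proof cases
        case 1
        then have "stem D d \<noteq> bot" by (intro stem_nontriv) auto
        then show ?thesis using 1 Inl by (simp add: \<Phi>_def)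
      next
        case 2
        then show ?thesis using linkD[of a] ck Inl by (simp add: \<Phi>_def link_def)
      qed
    next
      case (Inr f)
      then show ?thesis using G(1) by (simp add: \<Phi>_def filtermap_bot_iff)
    qed
    show "eventually (\<lambda>d. d \<in> D) (\<Phi> z)" for z
    proof (cases z)
      case (Inl p)
      then show ?thesis by (cases p) (simp add: \<Phi>_Inl eventually_stem_mem)
    next
      case (Inr f)
      have "eventually (\<lambda>k. (\<lambda>_. k0)(0 := k) \<in> D) (G f)"
        using G(2) by eventually_elim (rule DI[of _ 1], use k0 in auto)
      then show ?thesis using Inr by (simp add: \<Phi>_Inr)
    qed
    show "P d" if "d \<in> D" "eventually P (\<Phi> (\<iota> d))" for P d
      using that eventually_stem_self by (auto simp: \<iota>_def \<Phi>_Inl)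
    show "?sep y z" if "y \<in> Z" "z \<in> Z" "y \<noteq> z" for y z
    proof (cases y; cases z)
      fix p q assume "y = Inl p" "z = Inl q"
      then show ?thesis using that sep_ends[of p q] by (auto simp: Z_def)
    next
      fix p f assume "y = Inl p" "z = Inr f"
      then show ?thesis using sep_mixed by simp
    next
      fix f p assume "y = Inr f" "z = Inl p"
      then show ?thesis using sep_sym[OF sep_mixed] by simp
    next
      fix f g assume "y = Inr f" "z = Inr g"
      then show ?thesis using that sep_free[of f g] by (auto simp: Z_def)
    qed
  next
    fix A B a b
    assume AB: "A \<subseteq> D" "B \<subseteq> D" "a \<in> A" "b \<in> B"
      and A: "\<forall>d\<in>A. eventually (\<lambda>e. e \<in> A) (\<Phi> (\<iota> d))"
      and B: "\<forall>d\<in>B. eventually (\<lambda>e. e \<in> B) (\<Phi> (\<iota> d))"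
    have "eventually (\<lambda>e. e \<in> A) (stem D a)" "eventually (\<lambda>e. e \<in> B) (stem D b)"
      using bspec[OF A AB(3)] bspec[OF B AB(4)] by (simp_all add: \<iota>_def \<Phi>_Inl)
    then obtain m n where m: "\<forall>d\<in>D. (\<forall>i<m. d i = a i) \<longrightarrow> d \<in> A"
      and n: "\<forall>d\<in>D. (\<forall>i<n. d i = b i) \<longrightarrow> d \<in> B"
      by (auto simp: eventually_stem)
    have ab: "a \<in> D" "b \<in> D" using AB by auto
    \<comment> \<open>The cylinders of length \<open>N\<close> around \<open>a\<close> and
      \<open>b\<close> lie in \<open>A\<close> and \<open>B\<close>, and the link with this
      \<open>N\<close> keeps the first \<open>N\<close> values of each before its tails
      begin.\<close>
    define N where "N = max m n"
    define k where "k = c (a, b, N)"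
    have k: "k \<in> K" using ck ab by (simp add: k_def)
    have "\<exists>d\<in>D. (\<forall>i<j. d i = tail a N k i) \<and> d \<in> A" for j
      using tail_approx[OF ab(1) k, of j N] m by (auto simp: N_def)
    then have fA: "\<not> eventually (\<lambda>e. e \<notin> A) (stem D (tail a N k))"
      unfolding eventually_stem by blast
    have "\<exists>d\<in>D. (\<forall>i<j. d i = tail b N k i) \<and> d \<in> B" for j
      using tail_approx[OF ab(2) k, of j N] n by (auto simp: N_def)
    then have fB: "\<not> eventually (\<lambda>e. e \<notin> B) (stem D (tail b N k))"
      unfolding eventually_stem by blast
    show "\<exists>z\<in>Z. frequently (\<lambda>e. e \<in> A) (\<Phi> z) \<and> frequently (\<lambda>e. e \<in> B) (\<Phi> z)"
    proof (rule bexI)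
      show "Inl (link (a, b, N)) \<in> Z" using ab by (auto simp: Z_def S_def)
      \<comment> \<open>Along a \<open>sup\<close> of two stems it is enough to be frequent in one
        of them: the first end serves \<open>A\<close>, the second \<open>B\<close>.\<close>
      show "frequently (\<lambda>e. e \<in> A) (\<Phi> (Inl (link (a, b, N)))) \<and>
            frequently (\<lambda>e. e \<in> B) (\<Phi> (Inl (link (a, b, N))))"
        using fA fB by (simp add: link_def frequently_def \<Phi>_Inl k_def)
    qed
  qed
  then show ?thesis using h by (simp add: bij_betw_imp_surj_on)
qed

section \<open>Cardinal arithmetic and the choice of the ground set\<close>

lemma ctwo_cexp_ordIso_Pow: "Card_order r \<Longrightarrow> ctwo ^c r =o |Pow (Field r)|"
  unfolding ctwo_def cexp_def Field_card_of
  by (rule ordIso_symmetric[OF card_of_Pow_Func])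

lemma ctwo_ctwo_cexp_ordIso_Pow_Pow:
  assumes "Card_order r"
  shows "ctwo ^c (ctwo ^c r) =o |Pow (Pow (Field r))|"
proof -
  have "ctwo ^c (ctwo ^c r) =o ctwo ^c |Pow (Field r)|"
    using assms ctwo_cexp_ordIso_Pow
    by (intro cexp_cong2) (auto simp: Card_order_cexp card_of_Card_order Card_order_ctwo)
  also have "ctwo ^c |Pow (Field r)| =o |Pow (Field |Pow (Field r)| )|"
    by (rule ctwo_cexp_ordIso_Pow) (rule card_of_Card_order)
  finally show ?thesis by (simp add: Field_card_of)
qed

text \<open>If \<open>\<kappa> \<le>o \<mu>\<close>, the ground set is
  \<open>Field \<kappa>\<close>, with \<open>\<mu>\<close> many members of its double power set as
  indices. Otherwise that ground set would make the space too large; \<open>Field \<mu>\<close>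
  takes its place, with singletons of singletons as indices.\<close>

lemma ex_locally_card_le_anti_Urysohn_space:
  fixes \<kappa> :: "'k rel" and \<mu> :: "'l rel"
  assumes \<kappa>: "Cinfinite \<kappa>" and \<mu>: "Cinfinite \<mu>" and le: "\<mu> \<le>o ctwo ^c (ctwo ^c \<kappa>)"
  shows "\<exists>X :: 'l topology. locally_card_le \<kappa> X \<and> anti_Urysohn_space X \<and> |topspace X| =o \<mu>"
proof -
  have \<mu>F: "|Field \<mu>| =o \<mu>" and \<kappa>F: "|Field \<kappa>| =o \<kappa>"
    using \<mu> \<kappa> card_of_Field_ordIso by auto
  have inf: "infinite (Field \<kappa>)" "infinite (Field \<mu>)" using \<kappa> \<mu> by (auto simp: cinfinite_def)
  have "\<exists>X. topspace X = Field \<mu> \<and> anti_Urysohn_space X \<and> locally_card_le \<kappa> X"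
  proof (cases "\<kappa> \<le>o \<mu>")
    case True
    have "|Field \<mu>| \<le>o |Pow (Pow (Field \<kappa>))|"
      using \<kappa> ordIso_ordLeq_trans[OF \<mu>F ordLeq_ordIso_trans[OF le ctwo_ctwo_cexp_ordIso_Pow_Pow]] by simp
    then obtain e where e: "inj_on e (Field \<mu>)" "e ` Field \<mu> \<subseteq> Pow (Pow (Field \<kappa>))"
      unfolding card_of_ordLeq[symmetric] by blast
    have *: "|e ` Field \<mu>| =o |Field \<mu>|"
      using card_of_ordIsoI[OF inj_on_imp_bij_betw[OF e(1)]] by (rule ordIso_symmetric)
    have "|Field \<kappa>| \<le>o |Field \<mu>|" using True by (rule card_of_mono2)
    then have "|Field \<kappa>| \<le>o |e ` Field \<mu>|" by (rule ordLeq_ordIso_trans[OF _ ordIso_symmetric[OF *]])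
    then show ?thesis
      by (rule ex_anti_Urysohn_of_family[OF inf(1) e(2) _ * \<kappa> ordIso_imp_ordLeq[OF \<kappa>F]])
  next
    case False
    then have "\<mu> \<le>o \<kappa>"
      using \<kappa> \<mu> ordLeq_total[of \<kappa> \<mu>] by (auto dest: card_order_on_well_order_on)
    then have \<mu>\<kappa>: "|Field \<mu>| \<le>o \<kappa>" by (rule ordIso_ordLeq_trans[OF \<mu>F])
    define e :: "'l \<Rightarrow> 'l set set" where "e x = {{x}}" for x
    have e: "inj_on e (Field \<mu>)" "e ` Field \<mu> \<subseteq> Pow (Pow (Field \<mu>))"
      by (auto simp: e_def inj_on_def)
    have *: "|e ` Field \<mu>| =o |Field \<mu>|"
      using card_of_ordIsoI[OF inj_on_imp_bij_betw[OF e(1)]] by (rule ordIso_symmetric)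
    show ?thesis
      by (rule ex_anti_Urysohn_of_family[OF inf(2) e(2) ordIso_imp_ordLeq[OF ordIso_symmetric[OF *]] * \<kappa> \<mu>\<kappa>])
  qed
  then show ?thesis using \<mu>F by metis
qed

theorem corollary2p6:
  shows "(\<forall>\<kappa> :: 'k rel. Cinfinite \<kappa> \<longrightarrow>
            (\<forall>\<mu> :: 'l rel. Cinfinite \<mu> \<and> \<mu> \<le>o ctwo ^c (ctwo ^c \<kappa>) \<longrightarrow>
              (\<exists>X :: 'l topology.
                 locally_card_le \<kappa> X \<and> anti_Urysohn_space X \<and> |topspace X| =o \<mu>)))
       \<and> (\<forall>\<mu> :: 'l rel. Cinfinite \<mu> \<and> \<mu> \<le>o ctwo ^c continuum \<longrightarrow>
              (\<exists>X :: 'l topology.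
                 locally_countable X \<and> anti_Urysohn_space X \<and> |topspace X| =o \<mu>))"
  unfolding locally_countable_def continuum_def
proof (intro conjI allI impI, goal_cases)
  case 1
  then show ?case by (auto intro: ex_locally_card_le_anti_Urysohn_space)
next
  case 2
  then show ?case by (intro ex_locally_card_le_anti_Urysohn_space natLeq_Cinfinite) auto
qed

end
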